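(* Let $\{x_t\}_{t\in[0,1]}$ be a continuous-time Markov chain on the finite set $\mathcal X^d$ with rate matrix $\mathcal R_t$ ($\mathcal R_t(x,y)$ is the rate from $y$ to $x$), $x_0\sim q_{\mathrm{data}}$ and marginals $q_t$. Let $p^\theta_t>0$ be approximate marginals, $\hat p^\theta_s:=p^\theta_{1-s}$, $\alpha_s:=\hat p^\theta_s/\hat q_s$ with $\hat q_s=q_{1-s}$, and let the learned reverse rates be $\hat{\mathcal R}^\theta_t(y,x)=\mathcal R_t(x,y)\,p^\theta_t(y)/p^\theta_t(x)$ for $y\ne x$. Let $\hat{\mathscr L}_s$ be the generator of the reversed process $\hat x_s=x_{1-s}$, with path measure $\hat{\mathbb Q}$. Then there is a constant $C$ independent of $\theta$ such that $$\mathbb E_{\hat{\mathbb Q}}\left[\int_0^1\left(\frac{\hat{\mathscr L}_s\alpha_s(\hat x_s)}{\alpha_s(\hat x_s)}-\hat{\mathscr L}_s\log\alpha_s(\hat x_s)\right)ds\right]=\mathcal L_{\mathrm{DSE}}(\theta)+C,$$ where $$\mathcal L_{\mathrm{DSE}}(\theta)=\mathbb E_{x_0\sim q_{\mathrm{data}}}\int_0^1\mathbb E_{x_t\sim q(\cdot\mid x_0)}\left[\sum_{y\ne x_t}\left(\hat{\mathcal R}^\theta_t(y,x_t)-\mathcal R_t(x_t,y)\frac{q(y\mid x_0)}{q(x_t\mid x_0)}\log\hat{\mathcal R}^\theta_t(y,x_t)\right)\right]dt.$$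
   Context: $\mathcal X=\{1,\dots,K\}$. $\mathcal R_t$ is continuous in $t$, with $\mathcal R_t(x,y)\ge0$ for $x\neq y$ and columns summing to zero, and $\Pr(x_{t+h}=x\mid x_t=y)=\delta_{x,y}+\mathcal R_t(x,y)h+o(h)$. $q(\cdot\mid x_0)$ at time $t$ means the law $q_{t|0}(\cdot\mid x_0)$ of $x_t$ given $x_0$. It is assumed that $q_t(x)>0$ and $p_t^\theta(x)>0$ for all $x$ and all $t\in(0,1)$, and that the integrals involved are finite. Terms with $\mathcal R_t(x_t,y)=0$ are interpreted as $0$ (i.e. $0\log0=0$). The reversed generator is $\hat{\mathscr L}_s\phi(x)=\sum_y\mathcal R_{1-s}(x,y)\frac{q_{1-s}(y)}{q_{1-s}(x)}[\phi(y)-\phi(x)]$. (The left-hand side plus the entropy of $q_{\mathrm{data}}$ is the generator form of the negative evidence lower bound; "DSE" stands for denoising score entropy.) *)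

theory Defs
  imports "HOL-Probability.Probability" "HOL-Library.Landau_Symbols"
begin

(* Convention throughout: R t x y is the rate at time t of jumping from y to x,
   so the columns (sums over the first state) vanish. *)

definition rate_matrix :: "(real \<Rightarrow> 's::finite \<Rightarrow> 's \<Rightarrow> real) \<Rightarrow> bool" where
  "rate_matrix R \<longleftrightarrow>
     (\<forall>x y. continuous_on {0..1} (\<lambda>t. R t x y)) \<and>
     (\<forall>t\<in>{0..1}. \<forall>x y. x \<noteq> y \<longrightarrow> 0 \<le> R t x y) \<and>
     (\<forall>t\<in>{0..1}. \<forall>y. (\<Sum>x\<in>UNIV. R t x y) = 0)"

(* The state space is finite and discrete, so one-sided limits of a path are expressed
   by the path being constant on a one-sided neighbourhood.  Only X t with t in [0,1]
   is constrained. *)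

locale ctmc = prob_space M
  for M :: "'w measure"
    and X :: "real \<Rightarrow> 'w \<Rightarrow> 's::finite"
    and R :: "real \<Rightarrow> 's \<Rightarrow> 's \<Rightarrow> real" +
  assumes rates: "rate_matrix R"
    and state_measurable: "\<And>t. t \<in> {0..1} \<Longrightarrow> X t \<in> M \<rightarrow>\<^sub>M count_space UNIV"
    and right_continuous:
      "\<And>\<omega> t. \<omega> \<in> space M \<Longrightarrow> t \<in> {0..<1} \<Longrightarrow> \<forall>\<^sub>F u in at_right t. X u \<omega> = X t \<omega>"
    and left_limits:
      "\<And>\<omega> t. \<omega> \<in> space M \<Longrightarrow> t \<in> {0<..1} \<Longrightarrow> \<exists>x. \<forall>\<^sub>F u in at_left t. X u \<omega> = x"
    and markov:
      "\<And>J t u a x y.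
         0 \<le> t \<Longrightarrow> t < u \<Longrightarrow> u \<le> 1 \<Longrightarrow> finite J \<Longrightarrow> J \<subseteq> {0..<t} \<Longrightarrow>
         0 < \<P>(\<omega> in M. X t \<omega> = y \<and> (\<forall>r\<in>J. X r \<omega> = a r)) \<Longrightarrow>
         \<P>(\<omega> in M. X u \<omega> = x \<bar> X t \<omega> = y \<and> (\<forall>r\<in>J. X r \<omega> = a r)) =
         \<P>(\<omega> in M. X u \<omega> = x \<bar> X t \<omega> = y)"
    and jump_rates:
      "\<And>t x y. t \<in> {0..<1} \<Longrightarrow> 0 < \<P>(\<omega> in M. X t \<omega> = y) \<Longrightarrow>
         (\<lambda>h. \<P>(\<omega> in M. X (t + h) \<omega> = x \<bar> X t \<omega> = y) - ((if x = y then 1 else 0) + R t x y * h))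
           \<in> o[at_right 0](\<lambda>h. h)"

definition marginal :: "'w measure \<Rightarrow> (real \<Rightarrow> 'w \<Rightarrow> 's) \<Rightarrow> real \<Rightarrow> 's \<Rightarrow> real" where
  "marginal M X t x = \<P>(\<omega> in M. X t \<omega> = x)"

(* q_{t|0}(x | x0); equal to 0 if the state x0 has probability 0 at time 0. *)

definition cond_marginal :: "'w measure \<Rightarrow> (real \<Rightarrow> 'w \<Rightarrow> 's) \<Rightarrow> real \<Rightarrow> 's \<Rightarrow> 's \<Rightarrow> real" where
  "cond_marginal M X t x x0 = \<P>(\<omega> in M. X t \<omega> = x \<bar> X 0 \<omega> = x0)"

(* Time reversal turns right-continuous paths with left limits into left-continuous paths
   with right limits. *)

definition reversed_paths :: "(real \<Rightarrow> 's) set" where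
  "reversed_paths = {\<xi> \<in> extensional {0..1}.
     (\<forall>s\<in>{0<..1}. \<forall>\<^sub>F u in at_left s. \<xi> u = \<xi> s) \<and>
     (\<forall>s\<in>{0..<1}. \<exists>x. \<forall>\<^sub>F u in at_right s. \<xi> u = x)}"

definition reversed_path_space :: "(real \<Rightarrow> 's) measure" where
  "reversed_path_space =
     restrict_space (\<Pi>\<^sub>M s\<in>{0..1}. count_space UNIV) reversed_paths"

definition reversed_path_measure ::
    "'w measure \<Rightarrow> (real \<Rightarrow> 'w \<Rightarrow> 's) \<Rightarrow> (real \<Rightarrow> 's) measure" where
  "reversed_path_measure M X =
     distr M reversed_path_space (\<lambda>\<omega>. \<lambda>s\<in>{0..1}. X (1 - s) \<omega>)"

(* In the next two definitions q and p are time-dependent marginals in forward time t. *)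

definition reversed_generator ::
    "(real \<Rightarrow> 's::finite \<Rightarrow> 's \<Rightarrow> real) \<Rightarrow> (real \<Rightarrow> 's \<Rightarrow> real) \<Rightarrow> real \<Rightarrow> ('s \<Rightarrow> real) \<Rightarrow> 's \<Rightarrow> real" where
  "reversed_generator R q s \<phi> x =
     (\<Sum>y\<in>UNIV. R (1 - s) x y * (q (1 - s) y / q (1 - s) x) * (\<phi> y - \<phi> x))"

definition learned_rate ::
    "(real \<Rightarrow> 's \<Rightarrow> 's \<Rightarrow> real) \<Rightarrow> (real \<Rightarrow> 's pmf) \<Rightarrow> real \<Rightarrow> 's \<Rightarrow> 's \<Rightarrow> real" where
  "learned_rate R p t y x = R t x y * (pmf (p t) y / pmf (p t) x)"

definition marginal_ratio ::
    "'w measure \<Rightarrow> (real \<Rightarrow> 'w \<Rightarrow> 's) \<Rightarrow> (real \<Rightarrow> 's pmf) \<Rightarrow> real \<Rightarrow> 's \<Rightarrow> real" where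
  "marginal_ratio M X p s x = pmf (p (1 - s)) x / marginal M X (1 - s) x"

definition generator_integrand ::
    "'w measure \<Rightarrow> (real \<Rightarrow> 'w \<Rightarrow> 's::finite) \<Rightarrow> (real \<Rightarrow> 's \<Rightarrow> 's \<Rightarrow> real) \<Rightarrow>
     (real \<Rightarrow> 's pmf) \<Rightarrow> real \<Rightarrow> 's \<Rightarrow> real" where
  "generator_integrand M X R p s x =
     (let L = reversed_generator R (marginal M X) s; \<alpha> = marginal_ratio M X p s
      in L \<alpha> x / \<alpha> x - L (\<lambda>z. ln (\<alpha> z)) x)"

(* States x with q(x | x0) = 0 get weight 0, so the value of the quotient there is
   immaterial; ln 0 = 0 makes the terms with R t x y = 0 vanish. *)

definition dse_integrand ::
    "'w measure \<Rightarrow> (real \<Rightarrow> 'w \<Rightarrow> 's::finite) \<Rightarrow> (real \<Rightarrow> 's \<Rightarrow> 's \<Rightarrow> real) \<Rightarrow>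
     (real \<Rightarrow> 's pmf) \<Rightarrow> 's \<Rightarrow> real \<Rightarrow> real" where
  "dse_integrand M X R p x0 t =
     (\<Sum>x\<in>UNIV. cond_marginal M X t x x0 *
        (\<Sum>y\<in>UNIV - {x}. learned_rate R p t y x
           - R t x y * (cond_marginal M X t y x0 / cond_marginal M X t x x0)
               * ln (learned_rate R p t y x)))"

definition dse_loss ::
    "'w measure \<Rightarrow> (real \<Rightarrow> 'w \<Rightarrow> 's::finite) \<Rightarrow> (real \<Rightarrow> 's \<Rightarrow> 's \<Rightarrow> real) \<Rightarrow>
     's pmf \<Rightarrow> (real \<Rightarrow> 's pmf) \<Rightarrow> real" where
  "dse_loss M X R qdata p =
     measure_pmf.expectation qdata (\<lambda>x0. LINT t:{0..1}|lborel. dse_integrand M X R p x0 t)"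

end

theory Submission
  imports Defs
begin

text \<open>Put \<open>H(t) = \<Sum>\<^sub>x q\<^sub>t(x) G(1 - t, x)\<close> with \<open>G\<close> the generator integrand. Since \<open>r - 1 - ln r \<ge> 0\<close> the
  integrand is nonnegative, so Fubini applies and the expected path integral equals \<open>\<integral> H(t) dt\<close>.
  In the DSE loss the factor \<open>q(x | x0)\<close> cancels the denominator of the score, and averaging over
  \<open>x0\<close> turns \<open>q(\<cdot> | x0)\<close> into \<open>q\<^sub>t\<close>. Splitting the logarithms, the two integrands differ by an
  expression in \<open>R\<close> and \<open>q\<close> alone. That difference equals the difference of two integrable functions
  for any fixed parameter, which gives \<open>C\<close>.\<close>

section \<open>Countability and measurability on the real line\<close>

text \<open>A rational is chosen in the gap to the right of each such point. Gaps of different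
  points are disjoint because each gap avoids \<open>S\<close>, so the choice is injective.\<close>

lemma countable_right_isolated:
  fixes S :: "real set"
  shows "countable {t\<in>S. \<exists>b>t. \<forall>u. t < u \<and> u < b \<longrightarrow> u \<notin> S}" (is "countable ?T")
proof -
  have "\<forall>t\<in>?T. \<exists>r::rat. t < of_rat r \<and> (\<forall>u. t < u \<and> u < of_rat r \<longrightarrow> u \<notin> S)"
  proof
    fix t assume "t \<in> ?T"
    then obtain b where b: "b > t" "\<forall>u. t < u \<and> u < b \<longrightarrow> u \<notin> S" by blast
    obtain r where "t < of_rat r" "of_rat r < b" using of_rat_dense[OF b(1)] by blast
    then show "\<exists>r::rat. t < of_rat r \<and> (\<forall>u. t < u \<and> u < of_rat r \<longrightarrow> u \<notin> S)"
      using b(2) by (meson order.strict_trans)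
  qed
  then obtain r :: "real \<Rightarrow> rat"
    where r: "\<forall>t\<in>?T. t < of_rat (r t) \<and> (\<forall>u. t < u \<and> u < of_rat (r t) \<longrightarrow> u \<notin> S)"
    unfolding bchoice_iff by blast
  have "inj_on r ?T"
  proof (rule linorder_inj_onI')
    fix t t' assume tt: "t \<in> ?T" "t' \<in> ?T" "t < t'"
    have "t' < of_rat (r t')" "t' \<in> S" "\<forall>u. t < u \<and> u < of_rat (r t) \<longrightarrow> u \<notin> S"
      using r tt(1,2) by blast+
    then show "r t \<noteq> r t'" using tt(3) by metis
  qed
  then show ?thesis by (rule countableI')
qed

text \<open>Adding 1 to the floor, instead of taking the ceiling, keeps the grid point strictly
  above \<open>t\<close> even when \<open>t\<close> lies on the grid, as \<open>at_right t\<close>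
  demands. The excess is at most the mesh \<open>1 / Suc n\<close>.\<close>

lemma floor_approx_from_right:
  fixes t :: real
  shows "filterlim (\<lambda>n. (of_int \<lfloor>real (Suc n) * t\<rfloor> + 1) / real (Suc n)) (at_right t) sequentially"
proof -
  let ?r = "\<lambda>n. (of_int \<lfloor>real (Suc n) * t\<rfloor> + 1) / real (Suc n)"
  have gt: "t < ?r n" for n
    using floor_correct[of "real (Suc n) * t"] by (simp add: pos_less_divide_eq mult.commute)
  have le: "?r n \<le> t + 1 / real (Suc n)" for n
  proof -
    have "(t + 1 / real (Suc n)) * real (Suc n) = real (Suc n) * t + 1"
      by (simp add: distrib_right del: of_nat_Suc)
    then show ?thesis
      using floor_correct[of "real (Suc n) * t"]
      by (simp add: pos_divide_le_eq del: of_nat_Suc)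
  qed
  have "(\<lambda>n. t + 1 / real (Suc n)) \<longlonglongrightarrow> t + 0"
    by (intro tendsto_add tendsto_const LIMSEQ_Suc lim_1_over_n)
  then have "?r \<longlonglongrightarrow> t"
    by (intro tendsto_sandwich[of "\<lambda>_. t" ?r sequentially "\<lambda>n. t + 1 / real (Suc n)"])
      (use gt le in \<open>auto simp: less_imp_le\<close>)
  moreover have "\<forall>\<^sub>F n in sequentially. ?r n \<in> {t<..} \<and> ?r n \<noteq> t"
    by (intro always_eventually allI conjI less_imp_neq[OF gt, symmetric]) (simp only: greaterThan_iff gt)
  ultimately show ?thesis
    unfolding filterlim_at by blast
qed

text \<open>Reading \<open>Y\<close> at the next grid point to the right involves only countably
  many times for each mesh, so the discretised process is jointly measurable. Right constancy makes
  the discretisations eventually equal to \<open>Y\<close> at every point.\<close>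

lemma measurable_right_constant_process:
  fixes Y :: "real \<Rightarrow> 'w \<Rightarrow> 's::finite"
  assumes [measurable]: "\<And>t. Y t \<in> M \<rightarrow>\<^sub>M count_space UNIV"
    and right: "\<And>\<omega> t. \<omega> \<in> space M \<Longrightarrow> \<forall>\<^sub>F u in at_right t. Y u \<omega> = Y t \<omega>"
  shows "(\<lambda>(t, \<omega>). Y t \<omega>) \<in> borel \<Otimes>\<^sub>M M \<rightarrow>\<^sub>M count_space UNIV"
proof -
  let ?r = "\<lambda>n t. (of_int \<lfloor>real (Suc n) * t\<rfloor> + 1) / real (Suc n)"
  \<comment> \<open>Passing to real-valued indicators allows a limit theorem for functions into a
    metric space to be applied.\<close>
  have ind: "(\<lambda>z::real \<times> _. indicat_real {x} (Y (fst z) (snd z))) \<in> borel_measurable (borel \<Otimes>\<^sub>M M)" for x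
  proof (rule borel_measurable_LIMSEQ_metric)
    fix n
    have "(\<lambda>z::real \<times> _. (\<lambda>k w. indicat_real {x} (Y ((of_int k + 1) / real (Suc n)) (snd w)))
            \<lfloor>real (Suc n) * fst z\<rfloor> z) \<in> borel_measurable (borel \<Otimes>\<^sub>M M)"
      by (rule measurable_compose_countable) measurable
    then show "(\<lambda>z. indicat_real {x} (Y (?r n (fst z)) (snd z))) \<in> borel_measurable (borel \<Otimes>\<^sub>M M)"
      by simp
  next
    fix z :: "real \<times> _" assume "z \<in> space (borel \<Otimes>\<^sub>M M)"
    then have "snd z \<in> space M" by (auto simp: space_pair_measure)
    from right[OF this] floor_approx_from_right[of "fst z"]
    have "\<forall>\<^sub>F n in sequentially. Y (?r n (fst z)) (snd z) = Y (fst z) (snd z)"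
      unfolding filterlim_iff by blast
    then show "(\<lambda>n. indicat_real {x} (Y (?r n (fst z)) (snd z)))
        \<longlonglongrightarrow> indicat_real {x} (Y (fst z) (snd z))"
      by (intro tendsto_eventually) (auto elim: eventually_mono)
  qed
  show ?thesis
  proof (subst measurable_count_space_eq2, simp, safe)
    fix x
    have "{z \<in> space (borel \<Otimes>\<^sub>M M). indicat_real {x} (Y (fst z) (snd z)) = 1} \<in> sets (borel \<Otimes>\<^sub>M M)"
      using ind[of x] by measurable
    also have "{z \<in> space (borel \<Otimes>\<^sub>M M). indicat_real {x} (Y (fst z) (snd z)) = 1}
        = (\<lambda>(t, \<omega>). Y t \<omega>) -` {x} \<inter> space (borel \<Otimes>\<^sub>M M)"
      by (auto simp: indicator_def split: if_splits)
    finally show "(\<lambda>(t, \<omega>). Y t \<omega>) -` {x} \<inter> space (borel \<Otimes>\<^sub>M M) \<in> sets (borel \<Otimes>\<^sub>M M)" .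
  qed simp
qed

lemma filterlim_one_minus:
  fixes s :: real
  shows filterlim_one_minus_at_left: "filterlim (\<lambda>u. 1 - u) (at_right (1 - s)) (at_left s)"
    and filterlim_one_minus_at_right: "filterlim (\<lambda>u. 1 - u) (at_left (1 - s)) (at_right s)"
proof -
  have "((\<lambda>u. 1 - u) \<longlongrightarrow> 1 - s) (at s within A)" for A
    by (intro tendsto_intros)
  then show "filterlim (\<lambda>u. 1 - u) (at_right (1 - s)) (at_left s)"
    "filterlim (\<lambda>u. 1 - u) (at_left (1 - s)) (at_right s)"
    by (auto simp: filterlim_at eventually_at_filter)
qed

section \<open>Measurability of the chain and of its time reversal\<close>

context ctmc
begin

text \<open>Only \<open>X t\<close> with \<open>t \<in> {0..1}\<close> is constrained; clamping makes the process measurable and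
  right-constant at all real times.\<close>

abbreviation clamped_state :: "real \<Rightarrow> 'w \<Rightarrow> 's" where
  "clamped_state t \<equiv> X (max 0 (min 1 t))"

lemma clamped_state_measurable [measurable]: "clamped_state t \<in> M \<rightarrow>\<^sub>M count_space UNIV"
  by (rule state_measurable) auto

lemma clamped_state_right_constant:
  assumes "\<omega> \<in> space M"
  shows "\<forall>\<^sub>F u in at_right t. clamped_state u \<omega> = clamped_state t \<omega>"
proof -
  consider "t < 0" | "1 \<le> t" | "t \<in> {0..<1}" by fastforce
  then show ?thesis
  proof cases
    case 1
    show ?thesis
      using eventually_at_right_less[of t] eventually_at_right_real[OF 1]
      by eventually_elim (use 1 in auto)
  next
    case 2
    show ?thesis
      using eventually_at_right_less[of t] by eventually_elim (use 2 in auto)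
  next
    case 3
    then have "t < 1" by simp
    from right_continuous[OF assms 3] eventually_at_right_real[OF this] show ?thesis
      by eventually_elim (use 3 in auto)
  qed
qed

lemma clamped_state_measurable_pair: "(\<lambda>(t, \<omega>). clamped_state t \<omega>) \<in> borel \<Otimes>\<^sub>M M \<rightarrow>\<^sub>M count_space UNIV"
  by (rule measurable_right_constant_process) (use clamped_state_right_constant in auto)

text \<open>This form hands joint measurability in time and outcome to the \<open>measurable\<close>
  method.\<close>

lemma clamped_state_measurable_compose [measurable (raw)]:
  assumes "f \<in> borel_measurable N" "g \<in> N \<rightarrow>\<^sub>M M"
  shows "(\<lambda>z. clamped_state (f z) (g z)) \<in> N \<rightarrow>\<^sub>M count_space UNIV"
  using measurable_compose[OF measurable_Pair[OF assms] clamped_state_measurable_pair] by simp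

lemma event_measurable:
  "t \<in> {0..1} \<Longrightarrow> {\<omega> \<in> space M. X t \<omega> = x} \<in> events"
  using measurable_sets[OF state_measurable, of t "{x}"]
  by (simp add: vimage_def Int_def conj_commute)

lemma joint_event_measurable:
  assumes "t \<in> {0..1}" "u \<in> {0..1}"
  shows "{\<omega> \<in> space M. X t \<omega> = x \<and> X u \<omega> = y} \<in> events"
proof -
  have "{\<omega> \<in> space M. X t \<omega> = x \<and> X u \<omega> = y}
      = {\<omega> \<in> space M. X t \<omega> = x} \<inter> {\<omega> \<in> space M. X u \<omega> = y}" by auto
  then show ?thesis using event_measurable assms by simp
qed

text \<open>As the integral over \<open>M\<close> of an indicator that is jointly measurable in time
  and outcome, the probability depends measurably on time.\<close>

lemma marginal_measurable [measurable]:
  "(\<lambda>t. marginal M X (max 0 (min 1 t)) x) \<in> borel_measurable borel"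
proof -
  have "marginal M X (max 0 (min 1 t)) x = (\<integral>\<omega>. indicat_real {x} (clamped_state t \<omega>) \<partial>M)" for t
  proof -
    have "(\<integral>\<omega>. indicat_real {x} (clamped_state t \<omega>) \<partial>M) = (\<integral>\<omega>. indicat_real {\<omega> \<in> space M. clamped_state t \<omega> = x} \<omega> \<partial>M)"
      by (intro Bochner_Integration.integral_cong) (auto simp: indicator_def)
    then show ?thesis
      unfolding marginal_def by (simp add: Int_def conj_commute)
  qed
  moreover have "(\<lambda>t. \<integral>\<omega>. indicat_real {x} (clamped_state t \<omega>) \<partial>M) \<in> borel_measurable borel"
    by measurable
  ultimately show ?thesis by simp
qed

lemma R_measurable [measurable]:
  "(\<lambda>t. R (max 0 (min 1 t)) x y) \<in> borel_measurable borel"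
  by (intro borel_measurable_continuous_onI
      continuous_on_compose2[of "{0..1}" "\<lambda>t. R t x y" UNIV "\<lambda>t. max 0 (min 1 t)"] continuous_intros)
    (use rates in \<open>auto simp: rate_matrix_def\<close>)

lemma R_nonneg: "t \<in> {0..1} \<Longrightarrow> x \<noteq> y \<Longrightarrow> 0 \<le> R t x y"
  using rates by (auto simp: rate_matrix_def)

text \<open>This is what lets integrals and almost-everywhere statements under
  \<open>reversed_path_measure M X\<close> be pulled back to \<open>M\<close>. The map
  \<open>u \<mapsto> 1 - u\<close> exchanges left and right neighbourhoods, hence the two path
  conditions.\<close>

lemma reversed_path_measurable:
  "(\<lambda>\<omega>. \<lambda>s\<in>{0..1}. X (1 - s) \<omega>) \<in> M \<rightarrow>\<^sub>M reversed_path_space"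
  unfolding reversed_path_space_def
proof (rule measurable_restrict_space2)
  show "(\<lambda>\<omega>. \<lambda>s\<in>{0..1}. X (1 - s) \<omega>) \<in> M \<rightarrow>\<^sub>M (\<Pi>\<^sub>M s\<in>{0..1}. count_space UNIV)"
    by (rule measurable_restrict) (auto intro: state_measurable)
  show "(\<lambda>\<omega>. \<lambda>s\<in>{0..1}. X (1 - s) \<omega>) \<in> space M \<rightarrow> reversed_paths"
  proof
    fix \<omega> assume \<omega>: "\<omega> \<in> space M"
    have "\<forall>\<^sub>F u in at_left s. (\<lambda>s\<in>{0..1}. X (1 - s) \<omega>) u = (\<lambda>s\<in>{0..1}. X (1 - s) \<omega>) s"
      if s: "s \<in> {0<..1}" for s
    proof -
      have "\<forall>\<^sub>F u in at_left s. X (1 - u) \<omega> = X (1 - s) \<omega>"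
        using right_continuous[OF \<omega>, of "1 - s"] s filterlim_one_minus_at_left[of s]
        unfolding filterlim_iff by (elim allE[of _ "\<lambda>v. X v \<omega> = X (1 - s) \<omega>"]) auto
      \<comment> \<open>On this interval the restricted path agrees with
        \<open>X (1 - u) \<omega>\<close>; outside \<open>{0..1}\<close> it is
        \<open>undefined\<close>.\<close>
      moreover have "\<forall>\<^sub>F u in at_left s. u \<in> {0<..<s}"
        using s by (intro eventually_at_left_real) auto
      ultimately show ?thesis by eventually_elim (use s in auto)
    qed
    moreover have "\<exists>x. \<forall>\<^sub>F u in at_right s. (\<lambda>s\<in>{0..1}. X (1 - s) \<omega>) u = x"
      if s: "s \<in> {0..<1}" for s
    proof -
      obtain x where "\<forall>\<^sub>F u in at_left (1 - s). X u \<omega> = x"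
        using left_limits[OF \<omega>, of "1 - s"] s by auto
      then have "\<forall>\<^sub>F u in at_right s. X (1 - u) \<omega> = x"
        using filterlim_one_minus_at_right[of s]
        unfolding filterlim_iff by (elim allE[of _ "\<lambda>v. X v \<omega> = x"]) auto
      moreover have "\<forall>\<^sub>F u in at_right s. u \<in> {s<..<1}"
        using s by (intro eventually_at_right_real) auto
      ultimately have "\<forall>\<^sub>F u in at_right s. (\<lambda>s\<in>{0..1}. X (1 - s) \<omega>) u = x"
        by eventually_elim (use s in auto)
      then show ?thesis ..
    qed
    ultimately show "(\<lambda>s\<in>{0..1}. X (1 - s) \<omega>) \<in> reversed_paths"
      unfolding reversed_paths_def by simp
  qed
qed

section \<open>Marginals and conditional marginals\<close>

lemma expectation_state:
  assumes "t \<in> {0..1}"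
  shows "(\<integral>\<omega>. g (X t \<omega>) \<partial>M) = (\<Sum>x\<in>UNIV. marginal M X t x * (g x :: real))"
proof -
  have "(\<integral>\<omega>. g (X t \<omega>) \<partial>M) = (\<integral>\<omega>. (\<Sum>x\<in>UNIV. indicat_real {\<omega> \<in> space M. X t \<omega> = x} \<omega> * g x) \<partial>M)"
    by (intro Bochner_Integration.integral_cong refl)
      (simp add: indicator_def if_distrib[of "\<lambda>c. c * _"] sum.delta' cong: if_cong)
  also have "\<dots> = (\<Sum>x\<in>UNIV. \<integral>\<omega>. indicat_real {\<omega> \<in> space M. X t \<omega> = x} \<omega> * g x \<partial>M)"
    using event_measurable[OF assms]
    by (intro Bochner_Integration.integral_sum integrable_mult_left integrable_real_indicator)
      (auto simp: less_top[symmetric])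
  also have "\<dots> = (\<Sum>x\<in>UNIV. marginal M X t x * g x)"
    by (simp add: marginal_def Int_def conj_commute)
  finally show ?thesis .
qed

lemma total_probability:
  assumes "t \<in> {0..1}"
  shows "(\<Sum>x0\<in>UNIV. marginal M X 0 x0 * cond_marginal M X t x x0) = marginal M X t x"
proof -
  have "marginal M X 0 x0 * cond_marginal M X t x x0
      = prob {\<omega> \<in> space M. X t \<omega> = x \<and> X 0 \<omega> = x0}" for x0
  \<comment> \<open>For a null initial state the product vanishes through its first factor, and the
    joint event is null by monotonicity.\<close>
  proof (cases "prob {\<omega> \<in> space M. X 0 \<omega> = x0} = 0")
    case True
    have "prob {\<omega> \<in> space M. X t \<omega> = x \<and> X 0 \<omega> = x0} \<le> prob {\<omega> \<in> space M. X 0 \<omega> = x0}"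
      by (intro finite_measure_mono event_measurable) auto
    then show ?thesis
      using True measure_nonneg[of M] by (simp add: marginal_def order_antisym)
  qed (simp add: marginal_def cond_marginal_def cond_prob_def)
  then have "(\<Sum>x0\<in>UNIV. marginal M X 0 x0 * cond_marginal M X t x x0)
      = (\<Sum>x0\<in>UNIV. prob {\<omega> \<in> space M. X t \<omega> = x \<and> X 0 \<omega> = x0})"
    by simp
  also have "\<dots> = prob (\<Union>x0\<in>UNIV. {\<omega> \<in> space M. X t \<omega> = x \<and> X 0 \<omega> = x0})"
    using joint_event_measurable[OF assms, of 0]
    by (intro finite_measure_finite_Union[symmetric]) (auto simp: disjoint_family_on_def)
  also have "(\<Union>x0\<in>UNIV. {\<omega> \<in> space M. X t \<omega> = x \<and> X 0 \<omega> = x0}) = {\<omega> \<in> space M. X t \<omega> = x}"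
    by auto
  finally show ?thesis by (simp add: marginal_def)
qed

lemma cond_marginal_nonneg: "0 \<le> cond_marginal M X t x x0"
  by (simp add: cond_marginal_def cond_prob_def)

text \<open>Mass sitting at \<open>y\<close> at time \<open>t\<close> leaks into \<open>x\<close> at
  once: the transition probability is \<open>R t x y * h\<close> to first order, and the Markov
  property carries this over to the chain conditioned on its start \<open>x0\<close>.\<close>

lemma cond_marginal_eventually_pos:
  assumes t: "t \<in> {0<..<1}" and "x \<noteq> y" and "0 < R t x y" and "0 < cond_marginal M X t y x0"
  shows "\<forall>\<^sub>F u in at_right t. 0 < cond_marginal M X u x x0"
proof -
  let ?E = "{\<omega> \<in> space M. X t \<omega> = y \<and> X 0 \<omega> = x0}"
  have E: "0 < prob ?E" and x0: "0 < prob {\<omega> \<in> space M. X 0 \<omega> = x0}"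
    using assms(4) by (auto simp: cond_marginal_def cond_prob_def zero_less_divide_iff zero_less_measure_iff)
  have "prob ?E \<le> prob {\<omega> \<in> space M. X t \<omega> = y}"
    using t by (intro finite_measure_mono event_measurable) auto
  with E have y: "0 < prob {\<omega> \<in> space M. X t \<omega> = y}" by simp
  \<comment> \<open>The tolerance is half the rate, so that at least half of the leading term
    \<open>R t x y * h\<close> survives.\<close>
  have "\<forall>\<^sub>F h in at_right 0.
      norm (\<P>(\<omega> in M. X (t + h) \<omega> = x \<bar> X t \<omega> = y) - ((if x = y then 1 else 0) + R t x y * h))
        \<le> R t x y / 2 * norm h"
    using t y assms(3) by (intro landau_o.smallD[OF jump_rates]) auto
  moreover have "\<forall>\<^sub>F h in at_right 0. h \<in> {0<..<1 - t}"
    using t by (intro eventually_at_right_real) auto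
  ultimately have "\<forall>\<^sub>F h in at_right 0. 0 < cond_marginal M X (h + t) x x0"
  proof eventually_elim
    case (elim h)
    let ?u = "t + h"
    have "0 < R t x y * h" using elim(2) assms(3) by simp
    moreover have "\<bar>\<P>(\<omega> in M. X ?u \<omega> = x \<bar> X t \<omega> = y) - R t x y * h\<bar> \<le> R t x y * h / 2"
      using elim \<open>x \<noteq> y\<close> by simp
    ultimately have "0 < \<P>(\<omega> in M. X ?u \<omega> = x \<bar> X t \<omega> = y)"
      by linarith
    \<comment> \<open>The Markov property with the single past time 0, which precedes
      \<open>t\<close> since \<open>0 < t\<close>.\<close>
    also have "\<dots> = \<P>(\<omega> in M. X ?u \<omega> = x \<bar> X t \<omega> = y \<and> (\<forall>r\<in>{0}. X r \<omega> = (\<lambda>_. x0) r))"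
      using t elim(2) E by (intro markov[symmetric]) auto
    finally have "0 < prob {\<omega> \<in> space M. X ?u \<omega> = x \<and> X t \<omega> = y \<and> X 0 \<omega> = x0}"
      using E by (simp add: cond_prob_def zero_less_divide_iff)
    also have "\<dots> \<le> prob {\<omega> \<in> space M. X ?u \<omega> = x \<and> X 0 \<omega> = x0}"
      using t elim(2) by (intro finite_measure_mono joint_event_measurable) auto
    finally show ?case
      using x0 by (simp add: cond_marginal_def cond_prob_def add.commute)
  qed
  then show ?thesis
    by (subst at_right_to_0) (simp add: eventually_filtermap)
qed

text \<open>A zero of \<open>t \<mapsto> q(x | x0)\<close> with positive inflow is isolated from the right, so the junk
  value of the score quotient in the DSE integrand only matters on a null set.\<close>

lemma countable_inflow_at_zero:
  "countable {t\<in>{0<..<1}. \<exists>x0 x y. x \<noteq> y \<and> cond_marginal M X t x x0 = 0 \<and>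
     R t x y * cond_marginal M X t y x0 \<noteq> 0}"
proof -
  define T where "T x0 x = {t \<in> {t. cond_marginal M X t x x0 = 0}.
      \<exists>b>t. \<forall>u. t < u \<and> u < b \<longrightarrow> u \<notin> {t. cond_marginal M X t x x0 = 0}}" for x0 x
  have mem: "t \<in> T x0 x"
    if "t \<in> {0<..<1}" and "x \<noteq> y" and "cond_marginal M X t x x0 = 0"
      and "R t x y * cond_marginal M X t y x0 \<noteq> 0" for t x0 x y
  proof -
    have "\<forall>\<^sub>F u in at_right t. 0 < cond_marginal M X u x x0"
      using R_nonneg[of t x y] cond_marginal_nonneg[of t y x0] that
      by (intro cond_marginal_eventually_pos[of t x y]) auto
    then show ?thesis
      using that(3) by (force simp: eventually_at_right_field T_def)
  qed
  have "countable (\<Union>x0. \<Union>x. T x0 x)"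
    unfolding T_def by (intro countable_UN countable_right_isolated) auto
  then show ?thesis
  proof (rule countable_subset[rotated], intro subsetI)
    fix t assume "t \<in> {t\<in>{0<..<1}. \<exists>x0 x y. x \<noteq> y \<and> cond_marginal M X t x x0 = 0 \<and>
        R t x y * cond_marginal M X t y x0 \<noteq> 0}"
    then obtain x0 x where "t \<in> T x0 x" using mem by blast
    then show "t \<in> (\<Union>x0. \<Union>x. T x0 x)" by blast
  qed
qed

section \<open>The generator integrand\<close>

text \<open>The diagonal term is multiplied by \<open>\<phi> x - \<phi> x = 0\<close>, so only the
  nonnegative off-diagonal rates remain, and both generator terms share the same weights.\<close>

lemma generator_integrand_eq:
  "generator_integrand M X R p s x =
     (\<Sum>y\<in>UNIV - {x}. R (1 - s) x y * (marginal M X (1 - s) y / marginal M X (1 - s) x) *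
        ((marginal_ratio M X p s y - marginal_ratio M X p s x) / marginal_ratio M X p s x
         - (ln (marginal_ratio M X p s y) - ln (marginal_ratio M X p s x))))"
proof -
  have "reversed_generator R (marginal M X) s \<phi> x = (\<Sum>y\<in>UNIV - {x}.
      R (1 - s) x y * (marginal M X (1 - s) y / marginal M X (1 - s) x) * (\<phi> y - \<phi> x))" for \<phi>
    unfolding reversed_generator_def by (subst sum.remove[of UNIV x]) simp_all
  then show ?thesis
    unfolding generator_integrand_def Let_def
    by (simp only: sum_divide_distrib sum_subtractf[symmetric])
      (simp add: right_diff_distrib)
qed

lemma generator_integrand_nonneg:
  assumes s: "s \<in> {0<..<1}"
    and q: "\<And>x. 0 < marginal M X (1 - s) x" and p: "\<And>x. 0 < pmf (p (1 - s)) x"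
  shows "0 \<le> generator_integrand M X R p s x"
  unfolding generator_integrand_eq
proof (intro sum_nonneg mult_nonneg_nonneg)
  fix y assume "y \<in> UNIV - {x}"
  then show "0 \<le> R (1 - s) x y" using s by (intro R_nonneg) auto
  show "0 \<le> marginal M X (1 - s) y / marginal M X (1 - s) x" using q by (simp add: less_imp_le)
  have pos: "0 < marginal_ratio M X p s z" for z using p q by (simp add: marginal_ratio_def)
  have "ln (marginal_ratio M X p s y / marginal_ratio M X p s x)
      \<le> marginal_ratio M X p s y / marginal_ratio M X p s x - 1"
    using pos by (intro ln_le_minus_one) simp
  then show "0 \<le> (marginal_ratio M X p s y - marginal_ratio M X p s x) / marginal_ratio M X p s x
         - (ln (marginal_ratio M X p s y) - ln (marginal_ratio M X p s x))"
    using pos[of x] pos[of y] by (simp add: ln_div diff_divide_distrib)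
qed

text \<open>Inside the open interval clamping the time changes nothing, and outside it the indicator
  is 0. Every ingredient may therefore be replaced by its clamped version, which is Borel measurable
  on the whole line.\<close>

lemma generator_integrand_measurable:
  assumes "\<And>x. (\<lambda>t. pmf (p t) x) \<in> borel_measurable (restrict_space borel {0..1})"
  shows "(\<lambda>s. indicat_real {0<..<1} s * generator_integrand M X R p s x) \<in> borel_measurable borel"
proof -
  let ?c = "\<lambda>s::real. max 0 (min 1 (1 - s))"
  have c: "?c \<in> borel \<rightarrow>\<^sub>M restrict_space borel {0..1}"
    by (rule measurable_restrict_space2) auto
  have [measurable]: "(\<lambda>s. pmf (p (?c s)) x) \<in> borel_measurable borel" for x
    by (rule measurable_compose[OF c assms])
  have [measurable]: "(\<lambda>s. marginal M X (?c s) x) \<in> borel_measurable borel"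
    "(\<lambda>s. R (?c s) x y) \<in> borel_measurable borel" for x y
    by (rule measurable_compose[of "\<lambda>s. 1 - s", OF _ marginal_measurable]
        measurable_compose[of "\<lambda>s. 1 - s", OF _ R_measurable]; simp)+
  have "(\<lambda>s. indicat_real {0<..<1} s * generator_integrand M X R p s x) =
    (\<lambda>s. indicat_real {0<..<1} s *
     (\<Sum>y\<in>UNIV - {x}. R (?c s) x y * (marginal M X (?c s) y / marginal M X (?c s) x) *
        ((pmf (p (?c s)) y / marginal M X (?c s) y - pmf (p (?c s)) x / marginal M X (?c s) x)
           / (pmf (p (?c s)) x / marginal M X (?c s) x)
         - (ln (pmf (p (?c s)) y / marginal M X (?c s) y)
            - ln (pmf (p (?c s)) x / marginal M X (?c s) x)))))"
    unfolding generator_integrand_eq marginal_ratio_def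
    by (intro ext) (simp add: indicator_def)
  also have "\<dots> \<in> borel_measurable borel" by measurable
  finally show ?thesis .
qed

section \<open>The expected path integral as a time integral\<close>

text \<open>The finiteness conditions concern the closed interval, while the marginals are known to
  be positive only on the open one; the endpoints form a null set.\<close>

lemma set_lebesgue_integral_Icc_Ioo:
  fixes f :: "real \<Rightarrow> real"
  assumes "(\<lambda>s. indicat_real {a<..<b} s * f s) \<in> borel_measurable borel"
  shows "set_integrable lborel {a..b} f \<longleftrightarrow> integrable lborel (\<lambda>s. indicat_real {a<..<b} s * f s)"
    and "(LINT s:{a..b}|lborel. f s) = (\<integral>s. indicat_real {a<..<b} s * f s \<partial>lborel)"
proof -
  have ae: "AE s in lborel. indicat_real {a..b} s *\<^sub>R f s = indicat_real {a<..<b} s * f s"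
    by (rule AE_mp[OF AE_not_in[OF finite_imp_null_set_lborel[of "{a, b}"]]])
      (auto simp: indicator_def)
  \<comment> \<open>Since \<open>lborel\<close> is not complete, equality almost everywhere does not
    transfer measurability. The endpoint values are added explicitly instead; the guard
    \<open>a \<le> b\<close> covers the empty interval.\<close>
  have eq: "(\<lambda>s. indicat_real {a..b} s *\<^sub>R f s) = (\<lambda>s. indicat_real {a<..<b} s * f s +
      (if s = a \<and> a \<le> b then f a else if s = b \<and> a \<le> b then f b else 0))"
    by (auto simp: indicator_def of_bool_def fun_eq_iff)
  have m: "(\<lambda>s. indicat_real {a..b} s *\<^sub>R f s) \<in> borel_measurable borel"
    unfolding eq using assms by measurable
  show "set_integrable lborel {a..b} f \<longleftrightarrow> integrable lborel (\<lambda>s. indicat_real {a<..<b} s * f s)"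
    unfolding set_integrable_def using m assms ae by (intro integrable_cong_AE) auto
  show "(LINT s:{a..b}|lborel. f s) = (\<integral>s. indicat_real {a<..<b} s * f s \<partial>lborel)"
    unfolding set_lebesgue_integral_def using m assms ae by (intro integral_cong_AE) auto
qed

text \<open>The integral is pulled back from \<open>Q\<close> to \<open>M\<close> along the path
  reversal and then exchanged with the time integral.\<close>

lemma expectation_path_integral:
  fixes p :: "real \<Rightarrow> 's pmf"
  defines "Q \<equiv> reversed_path_measure M X"
    and "G \<equiv> generator_integrand M X R p"
  assumes q: "\<And>t x. t \<in> {0<..<1} \<Longrightarrow> 0 < marginal M X t x"
    and p: "\<And>t x. t \<in> {0<..<1} \<Longrightarrow> 0 < pmf (p t) x"
    and p_measurable: "\<And>x. (\<lambda>t. pmf (p t) x) \<in> borel_measurable (restrict_space borel {0..1})"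
    and path: "AE \<xi> in Q. set_integrable lborel {0..1} (\<lambda>s. G s (\<xi> s))"
    and expect: "integrable Q (\<lambda>\<xi>. LINT s:{0..1}|lborel. G s (\<xi> s))"
  shows "integrable lborel
      (\<lambda>s. indicat_real {0<..<1} s * (\<Sum>x\<in>UNIV. marginal M X (1 - s) x * G s x))" (is ?int)
    and "(\<integral>\<xi>. (LINT s:{0..1}|lborel. G s (\<xi> s)) \<partial>Q) =
      (\<integral>s. indicat_real {0<..<1} s * (\<Sum>x\<in>UNIV. marginal M X (1 - s) x * G s x) \<partial>lborel)" (is ?eq)
proof -
  interpret P: pair_sigma_finite M lborel ..
  let ?\<phi> = "\<lambda>\<omega>. \<lambda>s\<in>{0..1}. X (1 - s) \<omega>"
  define f where "f z = indicat_real {0<..<1} (snd z) * G (snd z) (clamped_state (1 - snd z) (fst z))" for z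
  have Gm [measurable]: "(\<lambda>s. indicat_real {0<..<1} s * G s x) \<in> borel_measurable borel" for x
    unfolding G_def by (rule generator_integrand_measurable[OF p_measurable])
  have f_meas [measurable]: "f \<in> borel_measurable (M \<Otimes>\<^sub>M lborel)"
  proof -
    \<comment> \<open>Summing over the finitely many states separates the time dependence of
      \<open>G\<close> from the random state, so that each factor is measurable by itself.\<close>
    have "f = (\<lambda>z. \<Sum>x\<in>UNIV. indicat_real {x} (clamped_state (1 - snd z) (fst z)) *
        (indicat_real {0<..<1} (snd z) * G (snd z) x))"
      unfolding f_def
      by (rule ext) (simp add: indicator_def if_distrib[of "\<lambda>c. c * _"] cong: if_cong)
    also have "\<dots> \<in> borel_measurable (M \<Otimes>\<^sub>M lborel)"
      by measurable
    finally show ?thesis .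
  qed
  have f_nonneg: "0 \<le> f z" for z
    unfolding f_def G_def using q p
    by (cases "snd z \<in> {0<..<1}") (auto intro!: generator_integrand_nonneg)
  have G_path: "(\<lambda>s. indicat_real {0<..<1} s * G s (?\<phi> \<omega> s)) = (\<lambda>s. f (\<omega>, s))" for \<omega>
    unfolding f_def by (auto simp: indicator_def)
  have G_path_meas: "(\<lambda>s. indicat_real {0<..<1} s * G s (?\<phi> \<omega> s)) \<in> borel_measurable borel"
    if "\<omega> \<in> space M" for \<omega>
    unfolding G_path using measurable_Pair2[OF f_meas that] by simp
  note conv = set_lebesgue_integral_Icc_Ioo[OF G_path_meas, unfolded G_path]
  have expect': "integrable M (\<lambda>\<omega>. LINT s:{0..1}|lborel. G s (?\<phi> \<omega> s))"
    and eq1: "(\<integral>\<xi>. (LINT s:{0..1}|lborel. G s (\<xi> s)) \<partial>Q)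
        = (\<integral>\<omega>. (LINT s:{0..1}|lborel. G s (?\<phi> \<omega> s)) \<partial>M)"
  proof -
    \<comment> \<open>Measurability of the path functional is read off from its integrability under
      \<open>Q\<close>, a measure with the sigma-algebra of
      \<open>reversed_path_space\<close>.\<close>
    have m: "(\<lambda>\<xi>. LINT s:{0..1}|lborel. G s (\<xi> s)) \<in> borel_measurable reversed_path_space"
      using borel_measurable_integrable[OF expect]
      by (simp add: Q_def reversed_path_measure_def cong: measurable_cong_sets)
    show "integrable M (\<lambda>\<omega>. LINT s:{0..1}|lborel. G s (?\<phi> \<omega> s))"
      using expect unfolding Q_def reversed_path_measure_def
      by (subst (asm) integrable_distr_eq[OF reversed_path_measurable m])
    show "(\<integral>\<xi>. (LINT s:{0..1}|lborel. G s (\<xi> s)) \<partial>Q)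
        = (\<integral>\<omega>. (LINT s:{0..1}|lborel. G s (?\<phi> \<omega> s)) \<partial>M)"
      unfolding Q_def reversed_path_measure_def
      by (rule integral_distr[OF reversed_path_measurable m])
  qed
  have "AE \<omega> in M. set_integrable lborel {0..1} (\<lambda>s. G s (?\<phi> \<omega> s))"
    using AE_distrD[OF reversed_path_measurable path[unfolded Q_def reversed_path_measure_def]] .
  then have "AE \<omega> in M. integrable lborel (\<lambda>s. f (\<omega>, s))"
    using AE_space by eventually_elim (use conv(1) in blast)
  \<comment> \<open>By nonnegativity the norm disappears, and the iterated integral required for
    Fubini is the path integral assumed integrable in \<open>expect\<close>.\<close>
  moreover have "integrable M (\<lambda>\<omega>. \<integral>s. norm (f (\<omega>, s)) \<partial>lborel)"
    using iffD1[OF Bochner_Integration.integrable_cong[OF refl conv(2)] expect'] f_nonneg by simp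
  ultimately have int: "integrable (M \<Otimes>\<^sub>M lborel) (\<lambda>(\<omega>, s). f (\<omega>, s))"
    by (intro P.Fubini_integrable) auto
  have inner: "(\<integral>\<omega>. f (\<omega>, s) \<partial>M)
      = indicat_real {0<..<1} s * (\<Sum>x\<in>UNIV. marginal M X (1 - s) x * G s x)" for s
    using expectation_state[of "1 - s" "G s"] by (simp add: f_def indicator_def)
  show ?int
    using P.integrable_snd[OF int] by (simp add: inner)
  show ?eq
    using P.Fubini_integral[OF int] Bochner_Integration.integral_cong[OF refl conv(2), of M]
    unfolding eq1 inner[symmetric] by simp
qed

section \<open>Pointwise comparison of the two integrands\<close>

text \<open>For a positive rate the bracket is the logarithm of the true reverse rate
  \<open>R t x y * marginal M X t y / marginal M X t x\<close>, minus 1; its weight is the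
  probability flux from \<open>y\<close> to \<open>x\<close>.\<close>

definition dse_gap :: "real \<Rightarrow> real" where
  "dse_gap t = (\<Sum>x\<in>UNIV. \<Sum>y\<in>UNIV - {x}. R t x y * marginal M X t y *
     (ln (R t x y) + ln (marginal M X t y) - ln (marginal M X t x) - 1))"

text \<open>The comparison is made for each ordered pair of states. The ratio
  \<alpha>(y)/\<alpha>(x), weighted by the reverse rate and q(x), yields q(x) times the learned
  rate, which cancels the first DSE term. The logarithms of \<open>p\<close> cancel because both
  carry the weight \<open>R t x y * marginal M X t y\<close>.\<close>

lemma generator_minus_dse_integrand:
  assumes t: "t \<in> {0<..<1}"
    and q: "\<And>x. 0 < marginal M X t x" and p: "\<And>x. 0 < pmf (p t) x"
    and no_inflow: "\<And>x0 x y :: 's. x \<noteq> y \<Longrightarrow> cond_marginal M X t x x0 = 0 \<Longrightarrow>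
      R t x y * cond_marginal M X t y x0 = 0"
  shows "(\<Sum>x\<in>UNIV. marginal M X t x * generator_integrand M X R p (1 - t) x)
      - (\<Sum>x0\<in>UNIV. marginal M X 0 x0 * dse_integrand M X R p x0 t) = dse_gap t"
proof -
  \<comment> \<open>Cancelling q(x | x0) is legitimate where it is nonzero. Where it is zero the
    original summand is 0, and \<open>no_inflow\<close> makes the cancelled form 0 as well.\<close>
  have "dse_integrand M X R p x0 t =
      (\<Sum>x\<in>UNIV. \<Sum>y\<in>UNIV - {x}. cond_marginal M X t x x0 * learned_rate R p t y x
         - cond_marginal M X t y x0 * (R t x y * ln (learned_rate R p t y x)))" for x0
    unfolding dse_integrand_def sum_distrib_left
  proof (intro sum.cong refl)
    fix x y :: 's assume "y \<in> UNIV - {x}"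
    then have "cond_marginal M X t x x0 = 0 \<Longrightarrow> R t x y * cond_marginal M X t y x0 = 0"
      using no_inflow[of x y x0] by auto
    then show "cond_marginal M X t x x0 * (learned_rate R p t y x
           - R t x y * (cond_marginal M X t y x0 / cond_marginal M X t x x0)
               * ln (learned_rate R p t y x))
        = cond_marginal M X t x x0 * learned_rate R p t y x
         - cond_marginal M X t y x0 * (R t x y * ln (learned_rate R p t y x))"
      by (cases "cond_marginal M X t x x0 = 0") (auto simp: field_simps)
  qed
  then have "(\<Sum>x0\<in>UNIV. marginal M X 0 x0 * dse_integrand M X R p x0 t) =
      (\<Sum>x0\<in>UNIV. \<Sum>x\<in>UNIV. \<Sum>y\<in>UNIV - {x}.
         marginal M X 0 x0 * cond_marginal M X t x x0 * learned_rate R p t y x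
         - marginal M X 0 x0 * cond_marginal M X t y x0 * (R t x y * ln (learned_rate R p t y x)))"
    by (simp add: sum_distrib_left right_diff_distrib mult.assoc)
  also have "\<dots> = (\<Sum>x\<in>UNIV. \<Sum>y\<in>UNIV - {x}. \<Sum>x0\<in>UNIV.
         marginal M X 0 x0 * cond_marginal M X t x x0 * learned_rate R p t y x
         - marginal M X 0 x0 * cond_marginal M X t y x0 * (R t x y * ln (learned_rate R p t y x)))"
    by (subst sum.swap, rule sum.cong[OF refl], rule sum.swap)
  also have "\<dots> = (\<Sum>x\<in>UNIV. \<Sum>y\<in>UNIV - {x}. marginal M X t x * learned_rate R p t y x
         - marginal M X t y * (R t x y * ln (learned_rate R p t y x)))"
    using t by (simp add: sum_subtractf sum_distrib_right[symmetric] total_probability)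
  finally have dse: "(\<Sum>x0\<in>UNIV. marginal M X 0 x0 * dse_integrand M X R p x0 t) = \<dots>" .
  show ?thesis
    unfolding dse generator_integrand_eq dse_gap_def sum_distrib_left sum_subtractf[symmetric]
  proof (intro sum.cong refl)
    fix x y :: 's assume "y \<in> UNIV - {x}"
    then have "0 \<le> R t x y" using t by (intro R_nonneg) auto
    \<comment> \<open>Splitting the logarithm of the learned rate requires a positive rate; at rate
      zero every term has a factor 0.\<close>
    then consider "R t x y = 0" | "0 < R t x y" by linarith
    then show "marginal M X t x * (R (1 - (1 - t)) x y * (marginal M X (1 - (1 - t)) y / marginal M X (1 - (1 - t)) x) *
        ((marginal_ratio M X p (1 - t) y - marginal_ratio M X p (1 - t) x) / marginal_ratio M X p (1 - t) x
         - (ln (marginal_ratio M X p (1 - t) y) - ln (marginal_ratio M X p (1 - t) x))))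
       - (marginal M X t x * learned_rate R p t y x
         - marginal M X t y * (R t x y * ln (learned_rate R p t y x)))
      = R t x y * marginal M X t y *
        (ln (R t x y) + ln (marginal M X t y) - ln (marginal M X t x) - 1)"
    proof cases
      case 2
      then show ?thesis
        using q[of x] q[of y] p[of x] p[of y]
        by (simp add: marginal_ratio_def learned_rate_def ln_mult ln_div)
          (simp add: field_simps)
    qed (simp add: learned_rate_def)
  qed
qed

end

section \<open>Integration over time and independence of the parameter\<close>

theorem mainTheorem6:
  fixes M :: "'w measure"
    and X :: "real \<Rightarrow> 'w \<Rightarrow> ('k::finite) ^ ('d::finite)"
    and R :: "real \<Rightarrow> 'k ^ 'd \<Rightarrow> 'k ^ 'd \<Rightarrow> real"
    and qdata :: "('k ^ 'd) pmf"
    and \<Theta> :: "'theta set"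
    and p :: "'theta \<Rightarrow> real \<Rightarrow> ('k ^ 'd) pmf"
  defines "Q \<equiv> reversed_path_measure M X"
  assumes chain: "ctmc M X R"
    and initial: "distr M (count_space UNIV) (X 0) = measure_pmf qdata"
    and q_pos: "\<And>t x. t \<in> {0<..<1} \<Longrightarrow> 0 < marginal M X t x"
    and p_pos: "\<And>\<theta> t x. \<theta> \<in> \<Theta> \<Longrightarrow> t \<in> {0<..<1} \<Longrightarrow> 0 < pmf (p \<theta> t) x"
    and p_measurable: "\<And>\<theta> x. \<theta> \<in> \<Theta> \<Longrightarrow>
      (\<lambda>t. pmf (p \<theta> t) x) \<in> borel_measurable (restrict_space borel {0..1})"
    and path_integral_finite: "\<And>\<theta>. \<theta> \<in> \<Theta> \<Longrightarrow>
      AE \<xi> in Q. set_integrable lborel {0..1} (\<lambda>s. generator_integrand M X R (p \<theta>) s (\<xi> s))"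
    and expectation_finite: "\<And>\<theta>. \<theta> \<in> \<Theta> \<Longrightarrow>
      integrable Q (\<lambda>\<xi>. LINT s:{0..1}|lborel. generator_integrand M X R (p \<theta>) s (\<xi> s))"
    and dse_finite: "\<And>\<theta> x0. \<theta> \<in> \<Theta> \<Longrightarrow> x0 \<in> set_pmf qdata \<Longrightarrow>
      set_integrable lborel {0..1} (dse_integrand M X R (p \<theta>) x0)"
  shows "\<exists>C::real. \<forall>\<theta>\<in>\<Theta>.
    (\<integral>\<xi>. (LINT s:{0..1}|lborel. generator_integrand M X R (p \<theta>) s (\<xi> s)) \<partial>Q) =
    dse_loss M X R qdata (p \<theta>) + C"
proof -
  interpret ctmc M X R by (rule chain)
  define H where "H \<theta> s = indicat_real {0<..<1} s *
    (\<Sum>x\<in>UNIV. marginal M X (1 - s) x * generator_integrand M X R (p \<theta>) s x)" for \<theta> s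
  \<comment> \<open>The DSE side is written in reversed time, to be compared with \<open>H\<close>
    at the same \<open>s\<close>.\<close>
  define D where "D \<theta> s = (\<Sum>x0\<in>UNIV. marginal M X 0 x0 *
    (indicat_real {0..1} (1 - s) * dse_integrand M X R (p \<theta>) x0 (1 - s)))" for \<theta> s
  have init: "marginal M X 0 x0 = pmf qdata x0" for x0
  proof -
    have "pmf qdata x0 = measure (distr M (count_space UNIV) (X 0)) {x0}"
      unfolding initial by (simp add: measure_pmf_single)
    also have "\<dots> = marginal M X 0 x0"
      using state_measurable[of 0]
      by (subst measure_distr) (auto simp: marginal_def vimage_def Int_def conj_commute)
    finally show ?thesis ..
  qed
  have H: "integrable lborel (H \<theta>)"
    "(\<integral>\<xi>. (LINT s:{0..1}|lborel. generator_integrand M X R (p \<theta>) s (\<xi> s)) \<partial>Q) = integral\<^sup>L lborel (H \<theta>)"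
    if "\<theta> \<in> \<Theta>" for \<theta>
    unfolding H_def Q_def using that
    by (intro expectation_path_integral q_pos p_pos p_measurable
        path_integral_finite[unfolded Q_def] expectation_finite[unfolded Q_def]; simp)+
  have D: "integrable lborel (D \<theta>)" "dse_loss M X R qdata (p \<theta>) = integral\<^sup>L lborel (D \<theta>)"
    if \<theta>: "\<theta> \<in> \<Theta>" for \<theta>
  proof -
    let ?g = "\<lambda>x0 t. indicat_real {0..1} t * dse_integrand M X R (p \<theta>) x0 t"
    have refl_int: "integrable lborel (\<lambda>s. ?g x0 (1 - s))"
      "(\<integral>s. ?g x0 (1 - s) \<partial>lborel) = (LINT t:{0..1}|lborel. dse_integrand M X R (p \<theta>) x0 t)"
      if "x0 \<in> set_pmf qdata" for x0
    proof -
      have "integrable lborel (?g x0)"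
        using dse_finite[OF \<theta> that] by (simp add: set_integrable_def)
      from lborel_integrable_real_affine[OF this, of "-1" 1]
      show "integrable lborel (\<lambda>s. ?g x0 (1 - s))" by simp
      show "(\<integral>s. ?g x0 (1 - s) \<partial>lborel) = (LINT t:{0..1}|lborel. dse_integrand M X R (p \<theta>) x0 t)"
        using lborel_integral_real_affine[of "-1" "?g x0" 1] by (simp add: set_lebesgue_integral_def)
    qed
    \<comment> \<open>Integrability is assumed only for initial states in the support of
      \<open>qdata\<close>; the others have weight 0.\<close>
    have term_int: "integrable lborel (\<lambda>s. marginal M X 0 x0 * ?g x0 (1 - s))" for x0
      using refl_int(1)[of x0] by (cases "x0 \<in> set_pmf qdata") (auto simp: init pmf_eq_0_set_pmf)
    then show "integrable lborel (D \<theta>)"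
      unfolding D_def by (intro Bochner_Integration.integrable_sum)
    have "dse_loss M X R qdata (p \<theta>)
        = (\<Sum>x0\<in>UNIV. pmf qdata x0 * (LINT t:{0..1}|lborel. dse_integrand M X R (p \<theta>) x0 t))"
      unfolding dse_loss_def by (subst integral_measure_pmf[of UNIV]) auto
    also have "\<dots> = (\<Sum>x0\<in>UNIV. \<integral>s. marginal M X 0 x0 * ?g x0 (1 - s) \<partial>lborel)"
    proof (rule sum.cong[OF refl])
      fix x0
      show "pmf qdata x0 * (LINT t:{0..1}|lborel. dse_integrand M X R (p \<theta>) x0 t)
          = (\<integral>s. marginal M X 0 x0 * ?g x0 (1 - s) \<partial>lborel)"
        using refl_int(2)[of x0] by (cases "x0 \<in> set_pmf qdata") (auto simp: init pmf_eq_0_set_pmf)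
    qed
    also have "\<dots> = integral\<^sup>L lborel (D \<theta>)"
      unfolding D_def using term_int by (intro Bochner_Integration.integral_sum[symmetric])
    finally show "dse_loss M X R qdata (p \<theta>) = integral\<^sup>L lborel (D \<theta>)" .
  qed
  let ?N = "{t\<in>{0<..<1}. \<exists>x0 x y. x \<noteq> y \<and> cond_marginal M X t x x0 = 0 \<and>
     R t x y * cond_marginal M X t y x0 \<noteq> 0}"
  \<comment> \<open>The exceptional times stay countable under time reversal.\<close>
  have "AE s in lborel. s \<notin> (\<lambda>t. 1 - t) ` ?N"
    by (intro AE_not_in countable_imp_null_set_lborel countable_image countable_inflow_at_zero)
  \<comment> \<open>At the endpoints \<open>H\<close> is 0 by its open indicator, while
    \<open>D\<close> keeps the values of the DSE integrand.\<close>
  moreover have "AE s in lborel. s \<notin> {0, 1::real}"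
    by (intro AE_not_in finite_imp_null_set_lborel) simp
  ultimately have gap: "AE s in lborel.
      H \<theta> s - D \<theta> s = (if s \<in> {0<..<1} then dse_gap (1 - s) else 0)" if "\<theta> \<in> \<Theta>" for \<theta>
  proof eventually_elim
    case (elim s)
    show ?case
    proof (cases "s \<in> {0<..<1}")
      case True
      then have t: "1 - s \<in> {0<..<1}" by simp
      have "1 - s \<notin> ?N"
        using elim(1) image_eqI[of s "\<lambda>t. 1 - t" "1 - s" ?N] by auto
      with t have ni: "\<And>x0 x y. x \<noteq> y \<Longrightarrow> cond_marginal M X (1 - s) x x0 = 0 \<Longrightarrow>
          R (1 - s) x y * cond_marginal M X (1 - s) y x0 = 0" by blast
      from generator_minus_dse_integrand[where p = "p \<theta>", OF t q_pos[OF t] p_pos[OF that t] ni] t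
      show ?thesis using True by (simp add: H_def D_def)
    qed (use elim(2) in \<open>auto simp: H_def D_def indicator_def\<close>)
  qed
  show ?thesis
  proof (cases "\<Theta> = {}")
    case False
    then obtain \<theta>\<^sub>0 where \<theta>\<^sub>0: "\<theta>\<^sub>0 \<in> \<Theta>" by blast
    have "integral\<^sup>L lborel (H \<theta>) - integral\<^sup>L lborel (D \<theta>)
        = integral\<^sup>L lborel (H \<theta>\<^sub>0) - integral\<^sup>L lborel (D \<theta>\<^sub>0)" if \<theta>: "\<theta> \<in> \<Theta>" for \<theta>
    proof -
      have "(\<integral>s. H \<theta> s - D \<theta> s \<partial>lborel) = (\<integral>s. H \<theta>\<^sub>0 s - D \<theta>\<^sub>0 s \<partial>lborel)"
      proof (rule integral_cong_AE)
        show "AE s in lborel. H \<theta> s - D \<theta> s = H \<theta>\<^sub>0 s - D \<theta>\<^sub>0 s"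
          using gap[OF \<theta>] gap[OF \<theta>\<^sub>0] by eventually_elim simp
      qed (use H(1) D(1) \<theta> \<theta>\<^sub>0 in \<open>auto intro!: borel_measurable_diff borel_measurable_integrable\<close>)
      then show ?thesis using H(1) D(1) \<theta> \<theta>\<^sub>0 by simp
    qed
    then show ?thesis
      using H(2) D(2)
      by (intro exI[of _ "integral\<^sup>L lborel (H \<theta>\<^sub>0) - integral\<^sup>L lborel (D \<theta>\<^sub>0)"]) (simp add: algebra_simps)
  qed simp
qed

end
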